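(* Let $\alpha \in \{2,3,4,5,6\}$ and let $u = \chi_{[-1/2,1/2]}$ be the characteristic function of the interval $[-1/2,1/2]$. Then $u$ is a local minimizer of the functional $$ J_\alpha(v) = \frac{\| \xi \cdot \widehat{v}(\xi)\|_{L^\infty(\mathbb{R})}^{\alpha} \cdot \| |x|^{\alpha} \cdot v\|_{L^1(\mathbb{R})}}{\|v\|_{L^1(\mathbb{R})}^{\alpha+1}}$$ in the class of even, smooth functions $f:[-1/2,1/2]\rightarrow\mathbb{R}$, in the following sense: for every even, smooth function $f:[-1/2,1/2]\rightarrow \mathbb{R}$ (extended by $0$ to $\mathbb{R}$) there exists $\varepsilon_0 > 0$ such that $$ J_\alpha(u + \varepsilon f) \geq J_\alpha(u) \qquad \text{for all } 0 < \varepsilon < \varepsilon_0.$$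
   Context: The Fourier transform is $\widehat{v}(\xi) = \int_{\mathbb{R}} v(x) e^{-2\pi i \xi x}\,dx$. A function on $[-1/2,1/2]$ is called smooth if it is $C^\infty$ up to the endpoints of the closed interval (it need not vanish at the endpoints); it is regarded as a function on $\mathbb{R}$ by extending it by $0$ outside $[-1/2,1/2]$. The functional $J_\alpha$ is defined for nonzero $v \in L^1(\mathbb{R})$, with values in $[0,\infty]$. *)

theory Defs
  imports "HOL-Probability.Essential_Supremum"
begin

definition fourier :: "(real \<Rightarrow> complex) \<Rightarrow> real \<Rightarrow> complex" where
  "fourier v \<xi> = (LINT x|lborel. v x * exp (- 2 * pi * \<i> * \<xi> * x))"

definition L1_norm :: "(real \<Rightarrow> 'a::real_normed_vector) \<Rightarrow> ennreal" where
  "L1_norm g = (\<integral>\<^sup>+x. ennreal (norm (g x)) \<partial>lborel)"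

definition Linf_norm :: "(real \<Rightarrow> 'a::real_normed_vector) \<Rightarrow> ennreal" where
  "Linf_norm g = esssup lborel (\<lambda>x. ennreal (norm (g x)))"

(* Meaningful for integrable v that do not vanish almost everywhere: the denominator is then
   finite and positive, and both factors of the numerator are positive (possibly infinite). *)
definition J :: "nat \<Rightarrow> (real \<Rightarrow> real) \<Rightarrow> ennreal" where
  "J \<alpha> v =
     Linf_norm (\<lambda>\<xi>. complex_of_real \<xi> * fourier (\<lambda>x. complex_of_real (v x)) \<xi>) ^ \<alpha>
       * L1_norm (\<lambda>x. \<bar>x\<bar> ^ \<alpha> * v x)
     / L1_norm v ^ (\<alpha> + 1)"

abbreviation I :: "real set" where
  "I \<equiv> {-1/2..1/2}"

definition u :: "real \<Rightarrow> real" where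
  "u = indicator I"

definition zero_extension :: "(real \<Rightarrow> real) \<Rightarrow> real \<Rightarrow> real" where
  "zero_extension f x = (if x \<in> I then f x else 0)"

definition even_on_I :: "(real \<Rightarrow> real) \<Rightarrow> bool" where
  "even_on_I f \<longleftrightarrow> (\<forall>x\<in>I. f (- x) = f x)"

(* D n is the n-th derivative of f on the closed interval; at the endpoints the derivatives
   are one-sided. Values of f outside the interval are irrelevant. *)
definition smooth_on_I :: "(real \<Rightarrow> real) \<Rightarrow> bool" where
  "smooth_on_I f \<longleftrightarrow>
     (\<exists>D :: nat \<Rightarrow> real \<Rightarrow> real.
        (\<forall>x\<in>I. D 0 x = f x) \<and>
        (\<forall>n. \<forall>x\<in>I. (D n has_real_derivative D (Suc n) x) (at x within I)))"

end

theory Submission imports Defs begin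

text \<open>Put \<open>\<kappa>\<^sub>n = (n + 1/2) \<pi>\<close> and let \<open>f\<close> be even and continuous, and
let \<open>U\<close> be the Fourier transform of \<open>u\<close>. The function \<open>\<bar>\<xi> U(\<xi>)\<bar> = \<bar>sin (\<pi>\<xi>)\<bar> / \<pi>\<close> attains
its maximum \<open>1/\<pi>\<close> at every half-integer \<open>\<xi> = n + 1/2\<close>, and for the perturbed function
the value there is \<open>(1 + \<epsilon> a\<^sub>n) / \<pi>\<close> with the antinode value \<open>a\<^sub>n = \<kappa>\<^sub>n (-1)\<^sup>n \<integral> f(x) cos (2 \<kappa>\<^sub>n x) dx\<close>.
For small \<open>\<epsilon>\<close> the function \<open>1 + \<epsilon> f\<close> is positive, so both \<open>L\<^sup>1\<close> norms are affine in \<open>\<epsilon>\<close>. Hence for every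
\<open>n\<close> the quotient \<open>J(u + \<epsilon> f) / J(u)\<close> is at least
\<open>(1 + \<epsilon> a\<^sub>n)\<^sup>\<alpha> (1 + \<epsilon> (\<alpha> + 1) \<integral> \<bar>2x\<bar>\<^sup>\<alpha> f) / (1 + \<epsilon> \<integral> f)\<^bsup>\<alpha> + 1\<^esup>\<close>,
and this is increasing at \<open>\<epsilon> = 0\<close> as soon as \<open>\<alpha> a\<^sub>n > (\<alpha> + 1) \<integral> f g\<close>, where \<open>g(x) = 1 - \<bar>2x\<bar>\<^sup>\<alpha>\<close>.

It remains to find such an \<open>n\<close>. The functions \<open>cos (2 \<kappa>\<^sub>n x)\<close> form a complete orthogonal system among the even
continuous functions on the interval (\<open>odd_cos_complete\<close>), and the profile \<open>g\<close>, which vanishes at the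
endpoints, has a uniformly convergent expansion in it. The decisive fact is that for
\<open>2 \<le> \<alpha> \<le> 6\<close> its \<open>n\<close>-th coefficient has the sign \<open>(-1)\<^sup>n\<close> (\<open>moment_sign\<close>). So Parseval
writes \<open>(\<alpha> + 1)/\<alpha> \<integral> f g\<close> as a combination of the \<open>a\<^sub>n\<close> with strictly positive weights, and the case
\<open>f = 1\<close> shows that the weights add up to 1. A weighted average is either exceeded by some \<open>a\<^sub>n\<close> or
equal to all of them. In the second case completeness makes \<open>f\<close> constant
(\<open>const_if_profile_dominates_antinodes\<close>), and then the perturbation is a multiple of \<open>u\<close>, on which \<open>J\<close>
has the same value.\<close>

section \<open>The odd cosine modes and their completeness\<close>

text \<open>The numbers \<open>\<kappa>\<^sub>n = (n + 1/2) \<pi>\<close> are the zeros of the cosine on the positive axis. The factor 2 in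
\<open>odd_cos\<close> makes the modes vanish at the endpoints \<open>\<plusminus>1/2\<close>; after the substitution \<open>y = 2x\<close> the
frequency on \<open>[0,1]\<close> is \<open>\<kappa>\<^sub>n\<close> itself.\<close>
definition half_freq :: "nat \<Rightarrow> real" where
  "half_freq n = (2 * real n + 1) * pi / 2"

definition odd_cos :: "nat \<Rightarrow> real \<Rightarrow> real" where
  "odd_cos n x = cos (2 * half_freq n * x)"

definition odd_coeff :: "nat \<Rightarrow> (real \<Rightarrow> real) \<Rightarrow> real" where
  "odd_coeff n f = integral I (\<lambda>x. f x * odd_cos n x)"

lemma half_freq_pos: "half_freq n > 0"
  by (simp add: half_freq_def add_nonneg_pos)

lemma half_freq_alt: "half_freq n = pi / 2 + real n * pi"
  by (simp add: half_freq_def field_simps)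

lemma cos_half_freq [simp]: "cos (half_freq n) = 0"
  by (simp add: half_freq_alt cos_add)

lemma sin_half_freq [simp]: "sin (half_freq n) = (-1) ^ n"
  by (simp add: half_freq_alt sin_add mult.commute)

lemma continuous_on_odd_cos [continuous_intros]: "continuous_on A (odd_cos n)"
  unfolding odd_cos_def by (intro continuous_intros)

lemma continuous_on_odd_cos' [continuous_intros]:
  "continuous_on A f \<Longrightarrow> continuous_on A (\<lambda>x. odd_cos n (f x))"
  by (rule continuous_on_compose2[OF continuous_on_odd_cos[of UNIV]]) auto

lemma odd_cos_uminus [simp]: "odd_cos n (- x) = odd_cos n x"
  by (simp add: odd_cos_def)

lemma abs_odd_cos_le: "\<bar>odd_cos n x\<bar> \<le> 1"
  by (simp add: odd_cos_def)

lemma integrable_on_I: "continuous_on I f \<Longrightarrow> f integrable_on I" for f :: "real \<Rightarrow> real"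
  by (rule integrable_continuous_real)

lemma odd_coeff_diff:
  assumes "continuous_on I f" "continuous_on I g"
  shows "odd_coeff n (\<lambda>x. f x - g x) = odd_coeff n f - odd_coeff n g"
  unfolding odd_coeff_def left_diff_distrib
  by (intro integral_diff integrable_on_I continuous_intros assms)

lemma odd_coeff_cmult: "odd_coeff n (\<lambda>x. c * f x) = c * odd_coeff n f"
  unfolding odd_coeff_def mult.assoc by simp

lemma bounded_on_I:
  fixes f :: "real \<Rightarrow> real"
  assumes "continuous_on I f"
  obtains B where "B > 0" "\<And>x. x \<in> I \<Longrightarrow> \<bar>f x\<bar> \<le> B"
proof -
  have "bounded (f ` I)"
    using assms compact_continuous_image compact_imp_bounded by blast
  then show thesis using that by (auto simp: bounded_pos)
qed

lemma abs_integral_I_le: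
  fixes f :: "real \<Rightarrow> real"
  assumes "continuous_on I f" "\<And>x. x \<in> I \<Longrightarrow> \<bar>f x\<bar> \<le> B"
  shows "\<bar>integral I f\<bar> \<le> B"
  using integral_bound[of "-1/2" "1/2" f B] assms by simp

text \<open>Multiplication by \<open>cos\<^sup>2 (\<pi>x)\<close> moves an odd mode only to the neighbouring odd modes. For \<open>n = 0\<close> the
lower neighbour has frequency \<open>-1\<close>, which is mode 0 again; truncated subtraction on
naturals gives exactly this.\<close>
lemma cos_sq_times_odd_cos:
  "(cos (pi * x))\<^sup>2 * odd_cos n x
     = odd_cos n x / 2 + odd_cos (Suc n) x / 4 + odd_cos (n - 1) x / 4"
proof -
  have double: "(cos (pi * x))\<^sup>2 = (1 + cos (2 * (pi * x))) / 2"
    by (simp add: cos_double_cos)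
  define t where "t = pi * x"
  have prod: "cos a * cos b = (cos (a + b) + cos (a - b)) / 2" for a b :: real
    by (simp add: cos_add cos_diff)
  have "cos (2 * t) * odd_cos n x = (odd_cos (Suc n) x + odd_cos (n - 1) x) / 2"
  proof (cases n)
    case 0
    have "cos (2 * t) * cos t = (cos (3 * t) + cos t) / 2"
      using prod[of "2 * t" t] by (simp add: algebra_simps)
    with 0 show ?thesis
      by (simp add: odd_cos_def half_freq_def t_def mult.assoc)
  next
    case (Suc m)
    have e: "2 * half_freq n * x = (2 * real m + 3) * t"
      "2 * half_freq (Suc n) * x = (2 * real m + 5) * t"
      "2 * half_freq (n - 1) * x = (2 * real m + 1) * t"
      by (simp_all add: Suc half_freq_def t_def algebra_simps)
    show ?thesis
      unfolding odd_cos_def e using prod[of "(2 * real m + 3) * t" "2 * t"]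
      by (simp add: algebra_simps)
  qed
  then have "(1 + cos (2 * t)) / 2 * odd_cos n x
      = odd_cos n x / 2 + (odd_cos (Suc n) x + odd_cos (n - 1) x) / 2 / 2"
    by (simp only: distrib_right add_divide_distrib times_divide_eq_left mult_1)
  then show ?thesis
    unfolding t_def[symmetric] double[folded t_def] by (simp add: add_divide_distrib del: distrib_right_numeral)
qed

text \<open>Orthogonality to all odd modes is inherited by the products with powers of \<open>cos\<^sup>2 (\<pi>x)\<close>, because
each such factor only mixes the modes.\<close>
lemma odd_coeff_times_cos_power:
  assumes f: "continuous_on I f" and zero: "\<And>n. odd_coeff n f = 0"
  shows "odd_coeff n (\<lambda>x. f x * (cos (pi * x))\<^sup>2 ^ j) = 0"
proof (induction j arbitrary: n)
  case 0
  then show ?case using zero by simp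
next
  case (Suc j)
  define F where "F = (\<lambda>x. f x * (cos (pi * x))\<^sup>2 ^ j)"
  have F: "continuous_on I F"
    unfolding F_def by (intro continuous_intros f)
  have "odd_coeff n (\<lambda>x. f x * (cos (pi * x))\<^sup>2 ^ Suc j)
      = integral I (\<lambda>x. F x * odd_cos n x / 2 + F x * odd_cos (Suc n) x / 4 
          + F x * odd_cos (n - 1) x / 4)"
    unfolding odd_coeff_def
  proof (rule integral_cong)
    fix x
    have "f x * (cos (pi * x))\<^sup>2 ^ Suc j * odd_cos n x
        = F x * ((cos (pi * x))\<^sup>2 * odd_cos n x)"
      by (simp add: F_def)
    then show "f x * (cos (pi * x))\<^sup>2 ^ Suc j * odd_cos n x
        = F x * odd_cos n x / 2 + F x * odd_cos (Suc n) x / 4 + F x * odd_cos (n - 1) x / 4"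
      unfolding cos_sq_times_odd_cos by (simp add: algebra_simps)
  qed
  also have "\<dots> = odd_coeff n F / 2 + odd_coeff (Suc n) F / 4 + odd_coeff (n - 1) F / 4"
    unfolding odd_coeff_def
    by (subst integral_add; (intro integrable_on_I continuous_intros F ballI; simp)?)+
       simp
  also have "\<dots> = 0"
    using Suc.IH by (simp add: F_def)
  finally show ?case .
qed

text \<open>Since \<open>f\<close> is even, it is a continuous function \<open>\<psi>\<close> of \<open>s = cos\<^sup>2 (\<pi>x)\<close>. The vanishing coefficients
make \<open>f\<close> orthogonal to \<open>cos (\<pi>x) p(cos\<^sup>2 (\<pi>x))\<close> for every polynomial \<open>p\<close>; approximating \<open>\<psi>\<close>
uniformly by polynomials gives \<open>\<integral> f\<^sup>2 cos (\<pi>x) = 0\<close>, and the weight is positive in the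
interior.\<close>
lemma odd_cos_complete:
  assumes f: "continuous_on I f" and ev: "even_on_I f"
    and zero: "\<And>n. odd_coeff n f = 0" and x: "x \<in> I"
  shows "f x = 0"
proof -
  have cos0: "odd_cos 0 y = cos (pi * y)" for y
    by (simp add: odd_cos_def half_freq_def)
  have poly: "integral I (\<lambda>x. f x * p ((cos (pi * x))\<^sup>2) * cos (pi * x)) = 0"
    if p: "real_polynomial_function p" for p
  proof -
    obtain a n where p: "p = (\<lambda>s. \<Sum>i\<le>n. a i * s ^ i)"
      using p real_polynomial_function_iff_sum by auto
    have "integral I (\<lambda>x. f x * p ((cos (pi * x))\<^sup>2) * cos (pi * x))
        = integral I (\<lambda>x. \<Sum>i\<le>n. a i * (f x * (cos (pi * x))\<^sup>2 ^ i * odd_cos 0 x))"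
      unfolding p cos0 sum_distrib_left sum_distrib_right by (simp add: mult_ac)
    also have "\<dots> = (\<Sum>i\<le>n. a i * odd_coeff 0 (\<lambda>x. f x * (cos (pi * x))\<^sup>2 ^ i))"
      unfolding odd_coeff_def
      by (subst integral_sum; (intro integrable_on_I continuous_intros f finite_atMost)?; simp)
    finally show ?thesis
      using odd_coeff_times_cos_power[OF f zero] by simp
  qed
  define \<psi> where "\<psi> s = f (arccos (sqrt s) / pi)" for s
  have \<psi>: "continuous_on {0..1} \<psi>"
    unfolding \<psi>_def
  proof (rule continuous_on_compose2[OF f])
    show "continuous_on {0..1} (\<lambda>s. arccos (sqrt s) / pi)"
      by (intro continuous_intros) (auto intro: order_trans[of _ 0])
    show "(\<lambda>s. arccos (sqrt s) / pi) ` {0..1} \<subseteq> I"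
    proof clarify
      fix s :: real assume "s \<in> {0..1}"
      then have "0 \<le> sqrt s" "sqrt s \<le> 1" by auto
      then have "0 \<le> arccos (sqrt s)" "arccos (sqrt s) \<le> pi / 2"
        using arccos_lbound[of "sqrt s"] arccos_le_pi2[of "sqrt s"] by linarith+
      then show "arccos (sqrt s) / pi \<in> I"
        by (auto simp: field_simps intro: order_trans[of _ 0])
    qed
  qed
  have cos_nonneg: "cos (pi * x) \<ge> 0" if "x \<in> I" for x
    using that mult_left_mono[of x "1/2" pi] mult_left_mono[of "-1/2" x pi]
    by (intro cos_ge_zero) (auto simp: field_simps)
  have \<psi>_cos: "\<psi> ((cos (pi * x))\<^sup>2) = f x" if x: "x \<in> I" for x
  proof -
    have "sqrt ((cos (pi * x))\<^sup>2) = cos (pi * \<bar>x\<bar>)"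
      using cos_nonneg[OF x] by (simp add: abs_if)
    moreover have "arccos (cos (pi * \<bar>x\<bar>)) = pi * \<bar>x\<bar>"
      using x mult_left_mono[of "\<bar>x\<bar>" 1 pi] by (intro arccos_cos) auto
    ultimately have "\<psi> ((cos (pi * x))\<^sup>2) = f \<bar>x\<bar>"
      by (simp add: \<psi>_def)
    also have "\<dots> = f x"
      using ev x by (auto simp: even_on_I_def abs_if)
    finally show ?thesis .
  qed
  \<comment> \<open>The aim is \<open>E = 0\<close>: every uniform approximation error \<open>e\<close> of \<open>\<psi>\<close> bounds \<open>E\<close> by \<open>B e\<close>.\<close>
  define E where "E = integral I (\<lambda>x. (f x)\<^sup>2 * cos (pi * x))"
  obtain B where B: "B > 0" "\<And>x. x \<in> I \<Longrightarrow> \<bar>f x\<bar> \<le> B"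
    using bounded_on_I[OF f] by blast
  have "\<bar>E\<bar> \<le> B * e" if e: "e > 0" for e
  proof -
    obtain p where p: "real_polynomial_function p"
      and pe: "\<And>s. s \<in> {0..1} \<Longrightarrow> \<bar>\<psi> s - p s\<bar> < e"
      using Stone_Weierstrass_real_polynomial_function[OF _ \<psi> e] by auto
    have cp: "continuous_on A (\<lambda>x. p ((cos (pi * x))\<^sup>2))" for A
      by (rule continuous_on_compose2[OF continuous_on_polymonial_function])
         (use p in \<open>auto simp: real_polynomial_function_eq intro!: continuous_intros\<close>)
    have "E = integral I (\<lambda>x. (f x)\<^sup>2 * cos (pi * x))
        - integral I (\<lambda>x. f x * p ((cos (pi * x))\<^sup>2) * cos (pi * x))"
      using poly[OF p] by (simp add: E_def)
    also have "\<dots> = integral I (\<lambda>x. (f x)\<^sup>2 * cos (pi * x)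
        - f x * p ((cos (pi * x))\<^sup>2) * cos (pi * x))"
      by (intro integral_diff[symmetric] integrable_on_I continuous_intros f cp)
    also have "\<bar>\<dots>\<bar> \<le> B * e"
    proof (rule abs_integral_I_le)
      fix x assume x: "x \<in> I"
      have "(cos (pi * x))\<^sup>2 \<in> {0..1}"
        by (simp add: abs_square_le_1)
      from pe[OF this] have "\<bar>f x - p ((cos (pi * x))\<^sup>2)\<bar> \<le> e"
        using \<psi>_cos[OF x] by simp
      then have "\<bar>f x\<bar> * \<bar>f x - p ((cos (pi * x))\<^sup>2)\<bar> * \<bar>cos (pi * x)\<bar> \<le> B * e * 1"
        using B(1) B(2)[OF x] by (intro mult_mono) auto
      then show "\<bar>(f x)\<^sup>2 * cos (pi * x) - f x * p ((cos (pi * x))\<^sup>2) * cos (pi * x)\<bar> \<le> B * e"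
        by (simp add: power2_eq_square abs_mult[symmetric] algebra_simps)
    qed (intro continuous_intros f cp)
    finally show ?thesis .
  qed
  \<comment> \<open>This error gives \<open>\<bar>E\<bar> \<le> \<bar>E\<bar> / 2\<close>.\<close>
  from this[of "\<bar>E\<bar> / (2 * B)"] have "E = 0"
    using B(1) by (cases "E = 0") auto
  moreover have "continuous_on I (\<lambda>x. (f x)\<^sup>2 * cos (pi * x))"
    by (intro continuous_intros f)
  ultimately have zero': "\<forall>x\<in>I. (f x)\<^sup>2 * cos (pi * x) = 0"
    unfolding E_def using cos_nonneg by (subst (asm) integral_eq_0_iff) auto
  have "f x = 0" if x: "x \<in> {-1/2<..<1/2}" for x
  proof -
    have "cos (pi * x) > 0"
      using x mult_strict_left_mono[of x "1/2" pi] mult_strict_left_mono[of "-1/2" x pi]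
      by (intro cos_gt_zero_pi) (auto simp: field_simps)
    then show ?thesis using zero' x by force
  qed
  then show ?thesis
    using continuous_constant_on_closure[of "{-1/2<..<1/2}" f 0 x] f x by simp
qed

section \<open>Uniformly convergent odd cosine series\<close>

text \<open>The series converges uniformly by the Weierstrass test, so it may be integrated term by term
against \<open>f\<close>.\<close>
lemma integral_odd_cos_series:
  assumes b: "summable (\<lambda>n. \<bar>b n\<bar>)" and f: "continuous_on I f"
  defines "G \<equiv> \<lambda>x. \<Sum>n. b n * odd_cos n x"
  shows "continuous_on I G"
    and "(\<lambda>n. b n * odd_coeff n f) sums integral I (\<lambda>x. f x * G x)"
proof -
  have le: "\<bar>b n * odd_cos n x\<bar> \<le> \<bar>b n\<bar>" for n x
    using mult_left_mono[OF abs_odd_cos_le[of n x], of "\<bar>b n\<bar>"] by (simp add: abs_mult)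
  have "uniform_limit I (\<lambda>n x. \<Sum>i<n. b i * odd_cos i x) G sequentially"
    unfolding G_def by (rule Weierstrass_m_test[OF _ b]) (use le in simp)
  then show G: "continuous_on I G"
    by (rule uniform_limit_theorem[rotated]) (auto intro!: always_eventually continuous_intros)
  obtain B where B: "B > 0" "\<And>x. x \<in> I \<Longrightarrow> \<bar>f x\<bar> \<le> B"
    using bounded_on_I[OF f] by blast
  have sm: "summable (\<lambda>n. b n * odd_cos n x)" for x
    by (rule summable_comparison_test'[OF b]) (use le in simp)
  have "uniform_limit I (\<lambda>n x. \<Sum>i<n. f x * (b i * odd_cos i x))
      (\<lambda>x. \<Sum>i. f x * (b i * odd_cos i x)) sequentially"
  proof (rule Weierstrass_m_test)
    show "summable (\<lambda>n. B * \<bar>b n\<bar>)" using b by (rule summable_mult)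
    show "norm (f x * (b n * odd_cos n x)) \<le> B * \<bar>b n\<bar>" if "x \<in> I" for n x
      using mult_mono[OF B(2)[OF that] le[of n x]] B(1) by (simp add: abs_mult)
  qed
  also have "(\<lambda>x. \<Sum>i. f x * (b i * odd_cos i x)) = (\<lambda>x. f x * G x)"
    unfolding G_def using suminf_mult[OF sm] by simp
  finally have lim: "uniform_limit I (\<lambda>n x. \<Sum>i<n. f x * (b i * odd_cos i x))
      (\<lambda>x. f x * G x) sequentially" .
  have cont: "continuous_on I (\<lambda>x. \<Sum>i<n. f x * (b i * odd_cos i x))" for n
    by (intro continuous_intros f)
  obtain L K where LK: "\<And>n. ((\<lambda>x. \<Sum>i<n. f x * (b i * odd_cos i x)) has_integral L n) I"
    "((\<lambda>x. f x * G x) has_integral K) I" "L \<longlonglongrightarrow> K"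
    using uniform_limit_integral[OF lim cont sequentially_bot] by blast
  have L: "L = (\<lambda>n. \<Sum>i<n. b i * odd_coeff i f)"
  proof
    fix n
    have "L n = integral I (\<lambda>x. \<Sum>i<n. b i * (f x * odd_cos i x))"
      using integral_unique[OF LK(1)[of n]] by (simp add: mult_ac)
    also have "\<dots> = (\<Sum>i<n. b i * odd_coeff i f)"
      unfolding odd_coeff_def
      by (subst integral_sum; (intro integrable_on_I continuous_intros f finite_lessThan)?; simp)
    finally show "L n = (\<Sum>i<n. b i * odd_coeff i f)" .
  qed
  show "(\<lambda>n. b n * odd_coeff n f) sums integral I (\<lambda>x. f x * G x)"
    using LK(3) unfolding sums_def L integral_unique[OF LK(2)] .
qed

lemma odd_coeff_odd_cos: "odd_coeff n (odd_cos m) = (if m = n then 1/2 else 0)"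
proof -
  have cosI: "integral I (\<lambda>x. cos (2 * real_of_int j * pi * x)) = (if j = 0 then 1 else 0)" for j :: int
  proof (cases "j = 0")
    case False
    have "((\<lambda>x. cos (2 * real_of_int j * pi * x)) has_integral
        sin (2 * real_of_int j * pi * (1/2)) / (2 * real_of_int j * pi)
        - sin (2 * real_of_int j * pi * (-1/2)) / (2 * real_of_int j * pi)) I"
      using False
      by (intro fundamental_theorem_of_calculus)
         (auto simp: has_real_derivative_iff_has_vector_derivative[symmetric]
            intro!: derivative_eq_intros)
    moreover have "sin (real_of_int j * pi) = 0"
      by (simp add: sin_integer_2pi sin_zero_iff_int2)
    ultimately show ?thesis
      using False by (simp add: integral_unique)
  qed simp
  have "odd_cos m x * odd_cos n x = 1/2 * cos (2 * real_of_int (int m - int n) * pi * x)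
      + 1/2 * cos (2 * real_of_int (int m + int n + 1) * pi * x)" for x
  proof -
    have "cos a * cos b = 1/2 * cos (a - b) + 1/2 * cos (a + b)" for a b :: real
      by (simp add: cos_add cos_diff field_simps)
    from this[of "2 * half_freq m * x" "2 * half_freq n * x"]
    have "odd_cos m x * odd_cos n x = 1/2 * cos (2 * half_freq m * x - 2 * half_freq n * x)
        + 1/2 * cos (2 * half_freq m * x + 2 * half_freq n * x)"
      by (simp only: odd_cos_def)
    also have "2 * half_freq m * x - 2 * half_freq n * x
        = 2 * real_of_int (int m - int n) * pi * x"
      by (simp add: half_freq_def field_simps)
    also have "2 * half_freq m * x + 2 * half_freq n * x
        = 2 * real_of_int (int m + int n + 1) * pi * x"
      by (simp add: half_freq_def field_simps)
    finally show ?thesis .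
  qed
  then have "odd_coeff n (odd_cos m)
      = integral I (\<lambda>x. 1/2 * cos (2 * real_of_int (int m - int n) * pi * x)
      + 1/2 * cos (2 * real_of_int (int m + int n + 1) * pi * x))"
    unfolding odd_coeff_def by (simp only:)
  also have "\<dots> = 1/2 * (if int m - int n = 0 then 1 else 0)
      + 1/2 * (if int m + int n + 1 = 0 then 1 else 0)"
    unfolding cosI[symmetric]
    by (subst integral_add; (intro integrable_on_I continuous_intros)?; simp)
  also have "\<dots> = (if m = n then 1/2 else 0)"
    by auto
  finally show ?thesis .
qed

text \<open>The series on the right converges uniformly and, by orthogonality, has the same coefficients as
\<open>g\<close>; completeness then identifies the two.\<close>
lemma odd_cos_expansion:
  assumes g: "continuous_on I g" and ev: "even_on_I g"
    and sm: "summable (\<lambda>n. \<bar>odd_coeff n g\<bar>)" and x: "x \<in> I"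
  shows "g x = (\<Sum>n. 2 * odd_coeff n g * odd_cos n x)"
proof -
  define b where "b n = 2 * odd_coeff n g" for n
  have b: "summable (\<lambda>n. \<bar>b n\<bar>)"
    unfolding b_def abs_mult by (intro summable_mult sm)
  define G where "G x = (\<Sum>n. b n * odd_cos n x)" for x
  have G: "continuous_on I G"
    unfolding G_def by (rule integral_odd_cos_series[OF b g])
  have "odd_coeff m G = odd_coeff m g" for m
  proof -
    have "(\<lambda>n. b n * odd_coeff n (odd_cos m)) sums odd_coeff m G"
      using integral_odd_cos_series(2)[OF b continuous_on_odd_cos[of I m]]
      unfolding odd_coeff_def[of _ G] G_def by (simp add: mult.commute)
    also have "(\<lambda>n. b n * odd_coeff n (odd_cos m)) = (\<lambda>n. if n = m then odd_coeff n g else 0)"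
      by (auto simp: odd_coeff_odd_cos b_def)
    finally show ?thesis
      by (rule sums_unique2) (rule sums_single)
  qed
  then have "odd_coeff m (\<lambda>x. g x - G x) = 0" for m
    using odd_coeff_diff[OF g G] by simp
  moreover have "continuous_on I (\<lambda>x. g x - G x)"
    by (intro continuous_intros g G)
  moreover have "even_on_I (\<lambda>x. g x - G x)"
    using ev by (simp add: even_on_I_def G_def)
  ultimately have "g x - G x = 0"
    using odd_cos_complete[of "\<lambda>x. g x - G x", OF _ _ _ x] by blast
  then show ?thesis by (simp add: G_def b_def)
qed

lemma odd_cos_parseval:
  assumes g: "continuous_on I g" and ev: "even_on_I g"
    and sm: "summable (\<lambda>n. \<bar>odd_coeff n g\<bar>)" and f: "continuous_on I f"
  shows "(\<lambda>n. 2 * odd_coeff n g * odd_coeff n f) sums integral I (\<lambda>x. f x * g x)"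
proof -
  have "summable (\<lambda>n. \<bar>2 * odd_coeff n g\<bar>)"
    unfolding abs_mult by (intro summable_mult sm)
  from integral_odd_cos_series(2)[OF this f]
  have "(\<lambda>n. 2 * odd_coeff n g * odd_coeff n f) sums
      integral I (\<lambda>x. f x * (\<Sum>n. 2 * odd_coeff n g * odd_cos n x))" .
  also have "integral I (\<lambda>x. f x * (\<Sum>n. 2 * odd_coeff n g * odd_cos n x))
      = integral I (\<lambda>x. f x * g x)"
    by (intro integral_cong) (simp only: odd_cos_expansion[OF g ev sm, symmetric])
  finally show ?thesis .
qed

section \<open>Coefficients of the profile \<open>1 - \<bar>2x\<bar>\<^sup>p\<close>\<close>

definition moment :: "nat \<Rightarrow> real \<Rightarrow> real" where
  "moment p k = integral {0..1} (\<lambda>y. y ^ p * cos (k * y))"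

lemma integral_even_rescale:
  assumes F: "continuous_on {0..1::real} F"
  shows "integral I (\<lambda>x. F \<bar>2 * x\<bar>) = (integral {0..1} F :: real)"
proof -
  define K where "K = integral {0..1} F"
  have K: "(F has_integral K) {0..1}"
    unfolding K_def by (intro integrable_integral integrable_continuous_real F)
  have im: "(\<lambda>x. x / 2) ` {0..1} = {0..1/2::real}" "(\<lambda>x. x / - 2) ` {0..1} = {-1/2..0::real}"
    by (auto simp: image_iff intro!: bexI[of _ "2 * _"] bexI[of _ "- 2 * _"])
  have 1: "((\<lambda>x. F \<bar>2 * x\<bar>) has_integral (1 / \<bar>2\<bar>) *\<^sub>R K) {0..1/2}"
    using has_integral_stretch_real[OF K, of 2, OF zero_neq_numeral[symmetric]] unfolding im
    by (rule has_integral_eq[rotated]) (auto simp: abs_if)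
  have 2: "((\<lambda>x. F \<bar>2 * x\<bar>) has_integral (1 / \<bar>-2\<bar>) *\<^sub>R K) {-1/2..0}"
    using has_integral_stretch_real[OF K, of "-2", OF neg_numeral_neq_zero] unfolding im
    by (rule has_integral_eq[rotated]) (auto simp: abs_if)
  show ?thesis
    using integral_unique[OF has_integral_combine[OF _ _ 2 1]] by (simp add: K_def)
qed

text \<open>For \<open>cos k = 0\<close> the moments are explicit: integrating by parts twice lowers \<open>p\<close> by two, and the
boundary terms at 1 reduce to \<open>sin k\<close>, which is \<open>\<plusminus>1\<close>.\<close>
lemma moment_rec:
  assumes k: "k \<noteq> 0" "cos k = 0"
  shows "moment 0 k = sin k / k"
    and "moment 1 k = sin k / k - 1 / k\<^sup>2"
    and "moment (p + 2) k = sin k / k - real ((p + 2) * (p + 1)) / k\<^sup>2 * moment p k"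
proof -
  define smoment where "smoment p = integral {0..1} (\<lambda>y. y ^ p * sin (k * y))" for p
  have m: "((\<lambda>y. y ^ p * cos (k * y)) has_integral moment p k) {0..1}" for p
    unfolding moment_def by (intro integrable_integral integrable_continuous_real continuous_intros)
  have sm: "((\<lambda>y. y ^ p * sin (k * y)) has_integral smoment p) {0..1}" for p
    unfolding smoment_def by (intro integrable_integral integrable_continuous_real continuous_intros)
  have dsin: "real p * smoment (p - 1) + k * moment p k = sin k" for p
  proof (rule has_integral_unique)
    show "((\<lambda>y. real p * (y ^ (p - 1) * sin (k * y)) + k * (y ^ p * cos (k * y)))
        has_integral real p * smoment (p - 1) + k * moment p k) {0..1}"
      by (intro has_integral_add has_integral_mult_right m sm)
    have "((\<lambda>y. real p * (y ^ (p - 1) * sin (k * y)) + k * (y ^ p * cos (k * y)))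
        has_integral 1 ^ p * sin (k * 1) - 0 ^ p * sin (k * 0)) {0..1}"
      by (intro fundamental_theorem_of_calculus)
         (auto simp: has_real_derivative_iff_has_vector_derivative[symmetric]
            intro!: derivative_eq_intros)
    then show "((\<lambda>y. real p * (y ^ (p - 1) * sin (k * y)) + k * (y ^ p * cos (k * y)))
        has_integral sin k) {0..1}" by simp
  qed
  have dcos: "real p * moment (p - 1) k - k * smoment p = - (0 ^ p)" for p
  proof (rule has_integral_unique)
    show "((\<lambda>y. real p * (y ^ (p - 1) * cos (k * y)) - k * (y ^ p * sin (k * y)))
        has_integral real p * moment (p - 1) k - k * smoment p) {0..1}"
      by (intro has_integral_diff has_integral_mult_right m sm)
    have "((\<lambda>y. real p * (y ^ (p - 1) * cos (k * y)) - k * (y ^ p * sin (k * y)))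
        has_integral 1 ^ p * cos (k * 1) - 0 ^ p * cos (k * 0)) {0..1}"
      by (intro fundamental_theorem_of_calculus)
         (auto simp: has_real_derivative_iff_has_vector_derivative[symmetric]
            intro!: derivative_eq_intros)
    then show "((\<lambda>y. real p * (y ^ (p - 1) * cos (k * y)) - k * (y ^ p * sin (k * y)))
        has_integral - (0 ^ p)) {0..1}" using k by simp
  qed
  show "moment 0 k = sin k / k"
    using dsin[of 0] k by (simp add: field_simps)
  have "smoment 0 = 1 / k"
    using dcos[of 0] k by (simp add: field_simps)
  moreover have "moment 1 k = sin k / k - smoment 0 / k"
    using dsin[of 1] k by (simp add: field_simps)
  ultimately show "moment 1 k = sin k / k - 1 / k\<^sup>2"
    by (simp add: power2_eq_square)
  have "smoment (p + 1) = real (p + 1) * moment p k / k"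
    using dcos[of "p + 1"] k by (simp add: field_simps)
  moreover have "moment (p + 2) k = sin k / k - real (p + 2) * smoment (p + 1) / k"
    using dsin[of "p + 2"] k by (simp add: field_simps)
  ultimately show "moment (p + 2) k = sin k / k - real ((p + 2) * (p + 1)) / k\<^sup>2 * moment p k"
    by (simp only: power2_eq_square of_nat_mult) simp
qed

lemma abs_moment_le: "\<bar>moment p k\<bar> \<le> 1"
proof -
  have "norm (integral {0..1} (\<lambda>y. y ^ p * cos (k * y))) \<le> 1 * (1 - 0)"
  proof (rule integral_bound)
    show "norm (y ^ p * cos (k * y)) \<le> 1" if "y \<in> {0..1}" for y
      using that by (auto simp: abs_mult power_abs intro!: mult_le_one power_le_one)
  qed (auto intro!: continuous_intros)
  then show ?thesis by (simp add: moment_def)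
qed

text \<open>The leading terms \<open>sin k / k\<close> of the moments of order 0 and \<open>p\<close> cancel in the difference, which
leaves a moment of order \<open>p - 2\<close> and the decay \<open>\<kappa>\<^sub>n\<^sup>-\<^sup>2\<close>.\<close>
lemma odd_coeff_profile:
  assumes "p \<ge> 2"
  shows "odd_coeff n (\<lambda>x. 1 - \<bar>2 * x\<bar> ^ p)
    = real (p * (p - 1)) / (half_freq n)\<^sup>2 * moment (p - 2) (half_freq n)"
proof -
  define k where "k = half_freq n"
  have k: "k \<noteq> 0" "cos k = 0"
    using half_freq_pos[of n] by (auto simp: k_def)
  have "odd_coeff n (\<lambda>x. 1 - \<bar>2 * x\<bar> ^ p)
      = integral I (\<lambda>x. (\<lambda>y. y ^ 0 * cos (k * y) - y ^ p * cos (k * y)) \<bar>2 * x\<bar>)"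
    unfolding odd_coeff_def
    by (rule integral_cong) (auto simp: odd_cos_def k_def abs_if algebra_simps)
  also have "\<dots> = integral {0..1} (\<lambda>y. y ^ 0 * cos (k * y) - y ^ p * cos (k * y))"
    by (intro integral_even_rescale continuous_intros)
  also have "\<dots> = moment 0 k - moment p k"
    unfolding moment_def
    by (intro integral_diff integrable_continuous_real continuous_intros)
  also have "\<dots> = real (p * (p - 1)) / k\<^sup>2 * moment (p - 2) k"
    using moment_rec(1)[OF k] moment_rec(3)[OF k, of "p - 2"] assms
    by (simp add: numeral_2_eq_2 Suc_diff_Suc)
  finally show ?thesis by (simp add: k_def)
qed

lemma summable_odd_coeff_profile:
  assumes "p \<ge> 2"
  shows "summable (\<lambda>n. \<bar>odd_coeff n (\<lambda>x. 1 - \<bar>2 * x\<bar> ^ p)\<bar>)"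
proof (rule summable_comparison_test'[where N = 0])
  have "summable (\<lambda>n. inverse (real (Suc n) ^ 2))"
    using inverse_power_summable[of 2, where 'a = real] by (subst summable_Suc_iff) simp
  then show "summable (\<lambda>n. real (p * (p - 1)) * inverse (real (Suc n) ^ 2))"
    by (rule summable_mult)
  fix n :: nat
  have "real (Suc n) \<le> half_freq n"
    using pi_gt3 mult_left_mono[of 2 pi "2 * real n + 1"] by (simp add: half_freq_def)
  then have "inverse ((half_freq n)\<^sup>2) \<le> inverse (real (Suc n) ^ 2)"
    by (intro le_imp_inverse_le power_mono) auto
  moreover have "\<bar>odd_coeff n (\<lambda>x. 1 - \<bar>2 * x\<bar> ^ p)\<bar>
      \<le> real (p * (p - 1)) * inverse ((half_freq n)\<^sup>2)"
    unfolding odd_coeff_profile[OF assms]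
    using mult_left_mono[OF abs_moment_le[of "p - 2" "half_freq n"],
        of "real (p * (p - 1)) / (half_freq n)\<^sup>2"]
    by (simp only: divide_inverse abs_mult abs_inverse abs_power2 abs_of_nat) simp
  ultimately have "\<bar>odd_coeff n (\<lambda>x. 1 - \<bar>2 * x\<bar> ^ p)\<bar>
      \<le> real (p * (p - 1)) * inverse (real (Suc n) ^ 2)"
    by (meson mult_left_mono of_nat_0_le_iff order_trans)
  then show "norm \<bar>odd_coeff n (\<lambda>x. 1 - \<bar>2 * x\<bar> ^ p)\<bar>
      \<le> real (p * (p - 1)) * inverse (real (Suc n) ^ 2)" by simp
qed

text \<open>With \<open>s = (-1)\<^sup>n\<close> and \<open>k = \<kappa>\<^sub>n\<close>, the recursion makes \<open>s\<close> times the moment a polynomial in \<open>k\<close> (and \<open>s\<close>)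
over a power of \<open>k\<close>. For \<open>p \<le> 2\<close> the bound \<open>k > 1.57\<close> makes it positive; for \<open>p = 3, 4\<close> the
first frequency \<open>k = \<pi>/2\<close> is treated apart from the others, \<open>k \<ge> 3\<pi>/2\<close>. For \<open>p = 4\<close>
the margin is small: \<open>z\<^sup>2 - 12 z + 24\<close> has the root \<open>6 - \<surd>12 \<approx> 2.54\<close>, just above \<open>z = \<pi>\<^sup>2/4 \<approx> 2.47\<close>.
The exponent in the profile is \<open>p + 2\<close>, so this sign is what limits it to at most 6.\<close>
lemma moment_sign:
  assumes "p \<le> 4"
  shows "0 < (-1) ^ n * moment p (half_freq n)"
proof -
  define k where "k = half_freq n"
  define s :: real where "s = (-1) ^ n"
  have k: "k \<noteq> 0" "cos k = 0" and sin: "sin k = s"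
    using half_freq_pos[of n] by (auto simp: k_def s_def)
  have s: "s = 1 \<or> s = -1" and ss: "s * s = 1"
    by (cases "even n"; simp add: s_def)+
  have first: "k = pi / 2 \<and> s = 1" if "n = 0"
    using that by (simp add: k_def s_def half_freq_def)
  have later: "k > 9/2" if "n \<noteq> 0"
  proof -
    have "3 * pi \<le> (2 * real n + 1) * pi"
      using that by (intro mult_right_mono) auto
    then have "9 < (2 * real n + 1) * pi"
      using pi_gt3 by linarith
    then show ?thesis
      by (simp add: k_def half_freq_def)
  qed
  have pi: "pi / 2 > 157/100" "pi / 2 < 158/100"
    using pi_approx by auto
  have k_gt: "k > 157/100"
    using first later pi by (cases "n = 0") auto
  have ksq: "k\<^sup>2 > 2"
    using power_strict_mono[OF k_gt, of 2] by (simp add: power2_eq_square)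
  have m0: "s * moment 0 k = 1 / k"
    using moment_rec(1)[OF k] ss sin by simp
  have m1: "s * moment 1 k = (k - s) / k ^ 2"
  proof -
    have "s * moment 1 k = (s * s) / k - s / k\<^sup>2"
      unfolding moment_rec(2)[OF k] sin by (simp add: right_diff_distrib)
    then show ?thesis
      using k unfolding ss by (simp add: field_simps power2_eq_square)
  qed
  have rec: "s * moment (p + 2) k = 1 / k - real ((p + 2) * (p + 1)) / k\<^sup>2 * (s * moment p k)" for p
    using ss unfolding moment_rec(3)[OF k] sin by (simp only: right_diff_distrib) simp
  have m2: "s * moment 2 k = (k\<^sup>2 - 2) / k ^ 3"
  proof -
    have "s * moment 2 k = 1 / k - 2 / k\<^sup>2 * (s * moment 0 k)"
      using rec[of 0, unfolded add_0] by simp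
    then show ?thesis
      unfolding m0 using k by (simp add: field_simps power_numeral_reduce)
  qed
  have m3: "s * moment 3 k = (k ^ 3 - 6 * k + 6 * s) / k ^ 4"
  proof -
    have "s * moment 3 k = 1 / k - 6 / k\<^sup>2 * (s * moment 1 k)"
      using rec[of 1] by (simp add: numeral_3_eq_3)
    then show ?thesis
      unfolding m1 using k by (simp add: field_simps power_numeral_reduce)
  qed
  have m4: "s * moment 4 k = (k ^ 4 - 12 * k\<^sup>2 + 24) / k ^ 5"
  proof -
    have "s * moment 4 k = 1 / k - 12 / k\<^sup>2 * (s * moment 2 k)"
      using rec[of 2] by simp
    then show ?thesis
      unfolding m2 using k by (simp add: field_simps power_numeral_reduce)
  qed
  have pos3: "k ^ 3 - 6 * k + 6 * s > 0"
  proof (cases "n = 0")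
    case True
    \<comment> \<open>The cubic has its minimum near \<open>\<surd>2\<close>, where it is about 0.34; the square at 3/2 exhibits the positivity.\<close>
    have "k ^ 3 - 6 * k + 6 = (k - 3/2)\<^sup>2 * (k + 3) + 3/4 * (k - 1)"
      by (simp add: field_simps power_numeral_reduce)
    also have "\<dots> > 0"
      using k_gt by (intro add_nonneg_pos mult_nonneg_nonneg) auto
    finally have "k ^ 3 - 6 * k + 6 > 0" .
    moreover have "s = 1" using first True by blast
    ultimately show ?thesis by simp
  next
    case False
    have "6 * k + 6 < k * 20"
      using later[OF False] by simp
    also have "\<dots> \<le> k * k\<^sup>2"
      using power_mono[of "9/2" k 2] later[OF False] by (intro mult_left_mono) (auto simp: power2_eq_square)
    finally show ?thesis
      using s by (auto simp: power_numeral_reduce)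
  qed
  have pos4: "k ^ 4 - 12 * k\<^sup>2 + 24 > 0"
  proof -
    define z where "z = k\<^sup>2"
    have z: "z < 5/2 \<or> z > 20"
    proof (cases "n = 0")
      case True
      then have "k * k < 158/100 * (158/100)"
        using first pi k_gt by (intro mult_strict_mono) auto
      then show ?thesis by (simp add: z_def power2_eq_square)
    next
      case False
      have "9/2 * (9/2) < k * k"
        using later[OF False] by (intro mult_strict_mono) auto
      then show ?thesis by (simp add: z_def power2_eq_square)
    qed
    have "0 < z" using k by (simp add: z_def)
    have "z * z - 12 * z + 24 > 0"
      using z
    proof
      assume z: "z < 5/2"
      have "0 < (5/2 - z) * (19/2 - z) + 1/4"
        using z by (intro add_nonneg_pos mult_nonneg_nonneg) auto
      then show ?thesis by (simp add: field_simps)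
    next
      assume "z > 20"
      then have "12 * z < z * z" by simp
      then show ?thesis by simp
    qed
    then show ?thesis by (simp add: z_def power_numeral_reduce)
  qed
  have "k > 0" using k_gt by simp
  consider "p = 0" | "p = 1" | "p = 2" | "p = 3" | "p = 4"
    using assms by linarith
  then have "0 < s * moment p k"
  proof cases
    case 1 then show ?thesis using m0 \<open>k > 0\<close> by simp
  next
    case 2
    have "k - s > 0" using k_gt s by auto
    then show ?thesis using 2 m1 \<open>k > 0\<close> by simp
  next
    case 3 then show ?thesis using m2 \<open>k > 0\<close> ksq by simp
  next
    case 4 then show ?thesis using m3 \<open>k > 0\<close> pos3 by simp
  next
    case 5 then show ?thesis using m4 \<open>k > 0\<close> pos4 by simp
  qed
  then show ?thesis by (simp add: k_def s_def)
qed

lemma odd_coeff_profile_sign: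
  assumes "2 \<le> p" "p \<le> 6"
  shows "0 < (-1) ^ n * odd_coeff n (\<lambda>x. 1 - \<bar>2 * x\<bar> ^ p)"
proof -
  have "0 < real (p * (p - 1)) / (half_freq n)\<^sup>2 * ((-1) ^ n * moment (p - 2) (half_freq n))"
    using assms half_freq_pos[of n] by (intro mult_pos_pos divide_pos_pos moment_sign) auto
  then show ?thesis
    unfolding odd_coeff_profile[OF assms(1)] by (simp only: mult.left_commute)
qed

section \<open>Antinode values and their weighted average\<close>

text \<open>Up to sign, \<open>\<pi> \<bar>\<xi> F(\<xi>)\<bar>\<close> at \<open>\<xi> = n + 1/2\<close>, where \<open>F\<close> is the Fourier transform of an even
function \<open>f\<close> on the interval, and \<open>U\<close> below is that of \<open>u\<close>. There \<open>sin (\<pi>\<xi>) = (-1)\<^sup>n\<close>, so these are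
the points where \<open>\<bar>\<xi> U(\<xi>)\<bar> = \<bar>sin (\<pi>\<xi>)\<bar> / \<pi>\<close> attains its maximum; the normalization gives the
constant function 1 the value 1 at each of them.\<close>
definition antinode :: "nat \<Rightarrow> (real \<Rightarrow> real) \<Rightarrow> real" where
  "antinode n f = half_freq n * ((-1) ^ n * odd_coeff n f)"

lemma odd_coeff_const: "odd_coeff n (\<lambda>_. c) = c * (-1) ^ n / half_freq n"
proof -
  have k: "half_freq n \<noteq> 0" using half_freq_pos[of n] by simp
  have "odd_coeff n (\<lambda>_. 1) = integral I (\<lambda>x. (\<lambda>y. y ^ 0 * cos (half_freq n * y)) \<bar>2 * x\<bar>)"
    unfolding odd_coeff_def
    by (rule integral_cong) (auto simp: odd_cos_def abs_if algebra_simps)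
  also have "\<dots> = moment 0 (half_freq n)"
    unfolding moment_def by (intro integral_even_rescale continuous_intros)
  also have "\<dots> = (-1) ^ n / half_freq n"
    using moment_rec(1)[OF k] by simp
  finally show ?thesis
    using odd_coeff_cmult[of n c "\<lambda>_. 1"] by simp
qed

lemma antinode_const [simp]: "antinode n (\<lambda>_. c) = c"
  using half_freq_pos[of n]
  by (simp add: antinode_def odd_coeff_const power_mult_distrib[symmetric] mult.left_commute)

lemma antinode_cmult: "antinode n (\<lambda>x. c * f x) = c * antinode n f"
  by (simp add: antinode_def odd_coeff_cmult)

lemma antinode_diff:
  assumes "continuous_on I f" "continuous_on I g"
  shows "antinode n (\<lambda>x. f x - g x) = antinode n f - antinode n g"
  by (simp add: antinode_def odd_coeff_diff[OF assms] right_diff_distrib)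

lemma integral_abs_power: "integral I (\<lambda>x. \<bar>2 * x\<bar> ^ p) = 1 / (real p + 1)"
proof -
  have rescale: "integral I (\<lambda>x. (\<lambda>y. y ^ p) \<bar>2 * x\<bar>) = integral {0..1} (\<lambda>y::real. y ^ p)"
    by (intro integral_even_rescale continuous_intros)
  have "((\<lambda>y::real. y ^ p) has_integral 1 ^ Suc p / real (Suc p) - 0 ^ Suc p / real (Suc p)) {0..1}"
    using DERIV_cdivide[OF DERIV_pow[of "Suc p"], of "real (Suc p)"] of_nat_neq_0[of p, where 'a = real]
    by (intro fundamental_theorem_of_calculus)
       (auto simp: has_real_derivative_iff_has_vector_derivative[symmetric] simp del: of_nat_Suc power_Suc)
  then have "integral {0..1} (\<lambda>y::real. y ^ p) = 1 / (real p + 1)"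
    by (simp add: integral_unique add.commute)
  then show ?thesis using rescale by simp
qed

text \<open>The functional \<open>f \<mapsto> (p + 1)/p \<integral> f (1 - \<bar>2x\<bar>\<^sup>p)\<close> is an average of the antinode values with strictly
positive weights, by Parseval and the sign of the coefficients of the profile. If no antinode value exceeds the
average \<open>A\<close>, then all of them equal \<open>A\<close>, so all coefficients of \<open>f - A\<close> vanish and completeness
gives \<open>f = A\<close>.\<close>
lemma const_if_profile_dominates_antinodes:
  assumes p: "2 \<le> p" "p \<le> 6"
    and f: "continuous_on I f" and ev: "even_on_I f"
    and le: "\<And>n. real p * antinode n f \<le> (real p + 1) * integral I (\<lambda>x. f x * (1 - \<bar>2 * x\<bar> ^ p))"
  shows "\<exists>A. \<forall>x\<in>I. f x = A"
proof -
  define g where "g x = 1 - \<bar>2 * x\<bar> ^ p" for x :: real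
  have g: "continuous_on I g"
    unfolding g_def by (intro continuous_intros)
  have evg: "even_on_I g"
    by (simp add: even_on_I_def g_def)
  have smg: "summable (\<lambda>n. \<bar>odd_coeff n g\<bar>)"
    using summable_odd_coeff_profile[OF p(1)] by (simp add: g_def[abs_def])
  have signg: "0 < (-1) ^ n * odd_coeff n g" for n
    using odd_coeff_profile_sign[OF p] by (simp add: g_def[abs_def])
  have intg: "integral I g = real p / (real p + 1)"
  proof -
    have "integral I g = integral I (\<lambda>x. 1) - integral I (\<lambda>x. \<bar>2 * x\<bar> ^ p)"
      unfolding g_def by (intro integral_diff integrable_on_I continuous_intros)
    then show ?thesis
      unfolding integral_abs_power by (simp add: field_simps)
  qed
  define A where "A = (real p + 1) / real p * integral I (\<lambda>x. f x * g x)"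
  define h where "h x = f x - A" for x
  have h: "continuous_on I h"
    unfolding h_def by (intro continuous_intros f)
  have sign_h: "(-1) ^ n * odd_coeff n h \<le> 0" for n
  proof -
    have "antinode n h = antinode n f - A"
      unfolding h_def using antinode_diff[OF f continuous_on_const, of n A] by simp
    also have "\<dots> \<le> 0"
      using le[of n] p by (simp add: A_def g_def field_simps)
    finally show ?thesis
      using half_freq_pos[of n] by (simp add: antinode_def mult_le_0_iff)
  qed
  \<comment> \<open>\<open>A\<close> is the average of \<open>f\<close>, so the average of \<open>h\<close> is zero, while all its terms have the same sign.\<close>
  have "integral I (\<lambda>x. h x * g x) = integral I (\<lambda>x. f x * g x - A * g x)"
    by (simp add: h_def algebra_simps)
  also have "\<dots> = integral I (\<lambda>x. f x * g x) - A * integral I g"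
    by (subst integral_diff; (intro integrable_on_I continuous_intros f g)?; simp)
  also have "\<dots> = 0"
    using p unfolding intg A_def by simp
  finally have "(\<lambda>n. 2 * odd_coeff n g * odd_coeff n h) sums 0"
    using odd_cos_parseval[OF g evg smg h] by simp
  then have "(\<lambda>n. - (2 * odd_coeff n g * odd_coeff n h)) sums 0"
    using sums_minus by fastforce
  moreover have "0 \<le> - (2 * odd_coeff n g * odd_coeff n h)" for n
  proof -
    have "((-1) ^ n * odd_coeff n g) * ((-1) ^ n * odd_coeff n h) \<le> 0"
      using signg[of n] sign_h[of n] by (simp add: mult_le_0_iff)
    then show ?thesis by (cases "even n") auto
  qed
  ultimately have "- (2 * odd_coeff n g * odd_coeff n h) = 0" for n
    using suminf_eq_zero_iff[of "\<lambda>n. - (2 * odd_coeff n g * odd_coeff n h)"]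
    unfolding sums_iff by blast
  then have zero: "odd_coeff n h = 0" for n
    using signg[of n] by (metis less_irrefl mult_eq_0_iff neg_equal_0_iff_equal zero_neq_numeral)
  have "even_on_I h"
    using ev by (simp add: even_on_I_def h_def)
  then have "\<forall>x\<in>I. h x = 0"
    using odd_cos_complete[OF h _ zero] by blast
  then show ?thesis by (auto simp: h_def)
qed

section \<open>Bounds for the functional\<close>

text \<open>For a continuous function the essential supremum bounds every value, since a closed set of full
Lebesgue measure is the whole line.\<close>
lemma norm_le_Linf_norm:
  fixes h :: "real \<Rightarrow> complex"
  assumes h: "continuous_on UNIV h"
  shows "ennreal (norm (h x)) \<le> Linf_norm h"
proof -
  have "closed {x. ennreal (norm (h x)) \<le> Linf_norm h}"
    by (intro closed_Collect_le continuous_on_ennreal continuous_intros h)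
  moreover have "AE x in lebesgue. x \<in> {x. ennreal (norm (h x)) \<le> Linf_norm h}"
    using esssup_AE[of "\<lambda>x. ennreal (norm (h x))" lborel]
    by (intro AE_completion) (simp add: Linf_norm_def)
  ultimately have "x \<in> {x. ennreal (norm (h x)) \<le> Linf_norm h}"
    by (rule mem_closed_if_AE_lebesgue)
  then show ?thesis by simp
qed

lemma Linf_norm_le:
  fixes h :: "real \<Rightarrow> complex"
  assumes h: "continuous_on UNIV h" and le: "\<And>x. norm (h x) \<le> B"
  shows "Linf_norm h \<le> ennreal B"
  unfolding Linf_norm_def
proof (rule esssup_I)
  have "h \<in> borel_measurable borel"
    using h by (rule borel_measurable_continuous_onI)
  then show "(\<lambda>x. ennreal (norm (h x))) \<in> borel_measurable lborel" by measurable
qed (use le in \<open>auto intro!: ennreal_leI\<close>)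

lemma L1_norm_zero_extension:
  assumes w: "continuous_on I w" and nonneg: "\<And>x. x \<in> I \<Longrightarrow> 0 \<le> w x"
  shows "L1_norm (zero_extension w) = ennreal (integral I w)"
proof -
  have int: "set_integrable lborel I w"
    by (rule borel_integrable_atLeastAtMost'[OF w])
  have "L1_norm (zero_extension w) = (\<integral>\<^sup>+x. ennreal (indicator I x *\<^sub>R w x) \<partial>lborel)"
    unfolding L1_norm_def by (intro nn_integral_cong) (auto simp: zero_extension_def nonneg)
  also have "\<dots> = ennreal (LINT x|lborel. indicator I x *\<^sub>R w x)"
    using int unfolding set_integrable_def
    by (rule nn_integral_eq_integral) (auto simp: indicator_def nonneg)
  also have "(LINT x|lborel. indicator I x *\<^sub>R w x) = integral I w"
    using set_borel_integral_eq_integral(2)[OF int] by (simp add: set_lebesgue_integral_def)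
  finally show ?thesis .
qed

lemma fourier_zero_extension:
  assumes w: "continuous_on I w"
  shows "fourier (\<lambda>x. complex_of_real (zero_extension w x)) \<xi>
    = integral I (\<lambda>x. w x * exp (- 2 * pi * \<i> * \<xi> * x))"
proof -
  have "set_integrable lborel I (\<lambda>x. complex_of_real (w x) * exp (- 2 * pi * \<i> * \<xi> * x))"
    by (intro borel_integrable_atLeastAtMost' continuous_intros w)
  from set_borel_integral_eq_integral(2)[OF this]
  have "(LINT x|lborel. indicator I x *\<^sub>R (complex_of_real (w x) * exp (- 2 * pi * \<i> * \<xi> * x)))
      = integral I (\<lambda>x. w x * exp (- 2 * pi * \<i> * \<xi> * x))"
    by (simp only: set_lebesgue_integral_def)
  moreover have "fourier (\<lambda>x. complex_of_real (zero_extension w x)) \<xi>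
      = (LINT x|lborel. indicator I x *\<^sub>R (complex_of_real (w x) * exp (- 2 * pi * \<i> * \<xi> * x)))"
    unfolding fourier_def
    by (intro Bochner_Integration.integral_cong) (auto simp: zero_extension_def)
  ultimately show ?thesis by simp
qed

lemma continuous_on_fourier_zero_extension:
  assumes w: "continuous_on I w"
  shows "continuous_on UNIV (\<lambda>\<xi>. complex_of_real \<xi> * fourier (\<lambda>x. complex_of_real (zero_extension w x)) \<xi>)"
proof -
  define g where "g \<xi> x = complex_of_real (w x) * exp (- 2 * pi * \<i> * \<xi> * x)" for \<xi> x :: real
  have "continuous_on (UNIV \<times> I) (\<lambda>z. g (fst z) (snd z))"
    unfolding g_def by (intro continuous_intros continuous_on_compose2[OF w]) auto
  then have "continuous_on (UNIV \<times> cbox (-1/2) (1/2)) (\<lambda>(\<xi>, x). g \<xi> x)"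
    by (simp add: case_prod_beta)
  then have "continuous_on UNIV (\<lambda>\<xi>. integral (cbox (-1/2) (1/2)) (g \<xi>))"
    by (rule integral_continuous_on_param)
  then show ?thesis
    unfolding fourier_zero_extension[OF w] g_def[abs_def] box_real by (intro continuous_intros)
qed

text \<open>Evaluation at \<open>\<xi> = \<kappa>\<^sub>n / \<pi>\<close>, where the real part of the transform is the cosine integral \<open>odd_coeff\<close>.\<close>
lemma Linf_norm_ge_antinode:
  assumes w: "continuous_on I w"
  shows "ennreal (\<bar>antinode n w\<bar> / pi)
    \<le> Linf_norm (\<lambda>\<xi>. complex_of_real \<xi> * fourier (\<lambda>x. complex_of_real (zero_extension w x)) \<xi>)"
proof -
  define \<xi> where "\<xi> = half_freq n / pi"
  define F where "F = fourier (\<lambda>x. complex_of_real (zero_extension w x)) \<xi>"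
  have "(\<lambda>x. complex_of_real (w x) * exp (- 2 * pi * \<i> * \<xi> * x)) integrable_on I"
    by (intro integrable_continuous_real continuous_intros w)
  then have "integral I (\<lambda>x. Re (complex_of_real (w x) * exp (- 2 * pi * \<i> * \<xi> * x))) = Re F"
    unfolding F_def fourier_zero_extension[OF w]
    by (intro integral_unique has_integral_Re integrable_integral)
  also have "integral I (\<lambda>x. Re (complex_of_real (w x) * exp (- 2 * pi * \<i> * \<xi> * x))) = odd_coeff n w"
    unfolding odd_coeff_def
    by (rule integral_cong) (simp add: odd_cos_def \<xi>_def Re_exp mult.commute mult.left_commute)
  finally have "\<bar>odd_coeff n w\<bar> \<le> norm F"
    using abs_Re_le_cmod[of F] by (simp only:)
  then have "\<bar>\<xi>\<bar> * \<bar>odd_coeff n w\<bar> \<le> norm (complex_of_real \<xi> * F)"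
    by (simp add: norm_mult mult_left_mono)
  moreover have "\<bar>antinode n w\<bar> / pi = \<bar>\<xi>\<bar> * \<bar>odd_coeff n w\<bar>"
    by (simp add: antinode_def \<xi>_def abs_mult power_abs)
  ultimately have "ennreal (\<bar>antinode n w\<bar> / pi) \<le> ennreal (norm (complex_of_real \<xi> * F))"
    by (intro ennreal_leI) simp
  also have "\<dots> \<le> Linf_norm (\<lambda>\<xi>. complex_of_real \<xi> * fourier (\<lambda>x. complex_of_real (zero_extension w x)) \<xi>)"
    unfolding F_def by (rule norm_le_Linf_norm[OF continuous_on_fourier_zero_extension[OF w]])
  finally show ?thesis .
qed

text \<open>For the Fourier transform \<open>U\<close> of \<open>u\<close>, the product \<open>\<xi> U(\<xi>)\<close> is up to a unimodular factor a difference of two unimodular numbers divided by \<open>2\<pi>\<close>, also for \<open>\<xi> = 0\<close>.\<close>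
lemma Linf_norm_one_le:
  "Linf_norm (\<lambda>\<xi>. complex_of_real \<xi> * fourier (\<lambda>x. complex_of_real (zero_extension (\<lambda>_. 1) x)) \<xi>)
    \<le> ennreal (1 / pi)"
proof (rule Linf_norm_le)
  have one: "continuous_on I (\<lambda>_. 1::real)" by (rule continuous_on_const)
  show "continuous_on UNIV (\<lambda>\<xi>. complex_of_real \<xi> *
      fourier (\<lambda>x. complex_of_real (zero_extension (\<lambda>_. 1) x)) \<xi>)"
    by (rule continuous_on_fourier_zero_extension[OF one])
  fix \<xi> :: real
  define E where "E x = exp (- 2 * pi * \<i> * \<xi> * complex_of_real x)" for x :: real
  have nE: "norm (E x) = 1" for x
    by (simp add: E_def)
  have "((\<lambda>x. - 2 * pi * \<i> * \<xi> * E x) has_integral E (1/2) - E (-1/2)) I"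
  proof (rule fundamental_theorem_of_calculus)
    fix x :: real
    have "((\<lambda>z. exp (- 2 * pi * \<i> * \<xi> * z)) has_field_derivative - 2 * pi * \<i> * \<xi> * E x) (at (complex_of_real x))"
      unfolding E_def by (auto intro!: derivative_eq_intros)
    then show "(E has_vector_derivative - 2 * pi * \<i> * \<xi> * E x) (at x within I)"
      unfolding E_def[abs_def] by (rule has_vector_derivative_real_field)
  qed simp
  then have "- 2 * pi * \<i> * \<xi> * integral I E = E (1/2) - E (-1/2)"
    by (simp only: integral_unique flip: integral_mult_right)
  then have "norm (E (1/2) - E (-1/2)) = norm (- 2 * pi * \<i> * \<xi> * integral I E)"
    by (simp only:)
  then have "2 * pi * norm (\<xi> * integral I E) = norm (E (1/2) - E (-1/2))"
    by (simp add: norm_mult)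
  also have "\<dots> \<le> 2"
    using norm_triangle_ineq4[of "E (1/2)" "E (-1/2)"] by (simp add: nE)
  finally have "norm (\<xi> * integral I E) \<le> 1 / pi"
    by (simp add: field_simps)
  then show "norm (complex_of_real \<xi> * fourier (\<lambda>x. complex_of_real (zero_extension (\<lambda>_. 1) x)) \<xi>) \<le> 1 / pi"
    unfolding fourier_zero_extension[OF one] by (simp add: E_def[abs_def])
qed

text \<open>The factor \<open>2\<^sup>p\<close> is split off so that the weight becomes \<open>\<bar>2x\<bar>\<^sup>p\<close>, the one in the profile.\<close>
lemma L1_norm_weighted:
  assumes w: "continuous_on I w" and nonneg: "\<And>x. x \<in> I \<Longrightarrow> 0 \<le> w x"
  shows "L1_norm (\<lambda>x. \<bar>x\<bar> ^ p * zero_extension w x)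
    = ennreal (integral I (\<lambda>x. \<bar>2 * x\<bar> ^ p * w x) / 2 ^ p)"
proof -
  have weighted: "(\<lambda>x. \<bar>x\<bar> ^ p * zero_extension w x) = zero_extension (\<lambda>x. \<bar>2 * x\<bar> ^ p * w x / 2 ^ p)"
    by (auto simp: zero_extension_def abs_mult power_mult_distrib)
  have "L1_norm (zero_extension (\<lambda>x. \<bar>2 * x\<bar> ^ p * w x / 2 ^ p))
      = ennreal (integral I (\<lambda>x. \<bar>2 * x\<bar> ^ p * w x / 2 ^ p))"
  proof (rule L1_norm_zero_extension)
    show "continuous_on I (\<lambda>x. \<bar>2 * x\<bar> ^ p * w x / 2 ^ p)"
      by (intro continuous_intros w ballI) simp
    show "0 \<le> \<bar>2 * x\<bar> ^ p * w x / 2 ^ p" if "x \<in> I" for x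
      using nonneg[OF that] by simp
  qed
  then show ?thesis
    unfolding weighted by simp
qed

lemma ennreal_power_ratio:
  assumes "0 \<le> a" "0 \<le> b" "0 < c"
  shows "ennreal a ^ p * ennreal b / ennreal c ^ q = ennreal (a ^ p * b / c ^ q)"
proof -
  have "ennreal a ^ p * ennreal b / ennreal c ^ q = ennreal (a ^ p * b) / ennreal (c ^ q)"
    using assms by (simp only: ennreal_power ennreal_mult'' less_imp_le)
  also have "\<dots> = ennreal (a ^ p * b / c ^ q)"
    using assms by (intro divide_ennreal) auto
  finally show ?thesis .
qed

lemma J_ge_antinode:
  assumes w: "continuous_on I w" and nonneg: "\<And>x. x \<in> I \<Longrightarrow> 0 \<le> w x"
    and pos: "0 < integral I w"
  shows "ennreal ((\<bar>antinode n w\<bar> / pi) ^ p * (integral I (\<lambda>x. \<bar>2 * x\<bar> ^ p * w x) / 2 ^ p)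
      / integral I w ^ (p + 1)) \<le> J p (zero_extension w)"
proof -
  define Q where "Q = integral I (\<lambda>x. \<bar>2 * x\<bar> ^ p * w x) / 2 ^ p"
  have Q: "0 \<le> Q"
    unfolding Q_def using nonneg
    by (intro divide_nonneg_pos integral_nonneg integrable_on_I continuous_intros w) auto
  have mass: "L1_norm (zero_extension w) = ennreal (integral I w)"
    by (rule L1_norm_zero_extension[OF w nonneg])
  have weight: "L1_norm (\<lambda>x. \<bar>x\<bar> ^ p * zero_extension w x) = ennreal Q"
    unfolding Q_def by (rule L1_norm_weighted[OF w nonneg])
  have "ennreal ((\<bar>antinode n w\<bar> / pi) ^ p * Q / integral I w ^ (p + 1))
      = ennreal (\<bar>antinode n w\<bar> / pi) ^ p * ennreal Q / ennreal (integral I w) ^ (p + 1)"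
    using Q pos by (subst ennreal_power_ratio) auto
  also have "\<dots> \<le> J p (zero_extension w)"
    unfolding J_def mass weight
    by (intro divide_right_mono_ennreal mult_right_mono power_mono Linf_norm_ge_antinode w) auto
  finally show ?thesis by (simp only: Q_def)
qed

lemma J_u_le: "J p u \<le> ennreal ((1 / pi) ^ p * (1 / (real p + 1) / 2 ^ p))"
proof -
  have one: "continuous_on I (\<lambda>_. 1::real)" by (rule continuous_on_const)
  have u: "u = zero_extension (\<lambda>_. 1)"
    by (auto simp: u_def zero_extension_def indicator_def)
  have "J p u \<le> ennreal (1 / pi) ^ p * ennreal (1 / (real p + 1) / 2 ^ p) / ennreal (integral I (\<lambda>_. 1::real)) ^ (p + 1)"
    unfolding J_def u L1_norm_zero_extension[OF one zero_le_one] L1_norm_weighted[OF one zero_le_one]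
      mult_1_right integral_abs_power
    by (intro divide_right_mono_ennreal mult_right_mono power_mono Linf_norm_one_le) auto
  also have "\<dots> = ennreal ((1 / pi) ^ p * (1 / (real p + 1) / 2 ^ p))"
    by (subst ennreal_power_ratio) auto
  finally show ?thesis .
qed

section \<open>Local minimality\<close>

text \<open>Reduction to real numbers: bounding the supremum norm of the perturbed function from below by
one antinode value leaves only the three linear functionals of \<open>f\<close> in the inequality. Positivity of
\<open>1 + \<epsilon> f\<close> makes both \<open>L\<^sup>1\<close> norms affine in \<open>\<epsilon>\<close>.\<close>
lemma J_perturbation_ge:
  assumes f: "continuous_on I f" and pos: "\<And>x. x \<in> I \<Longrightarrow> 0 < 1 + \<epsilon> * f x"
    and ineq: "(1 + \<epsilon> * integral I f) ^ (p + 1) \<le>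
      (1 + \<epsilon> * antinode n f) ^ p * (1 + \<epsilon> * ((real p + 1) * integral I (\<lambda>x. \<bar>2 * x\<bar> ^ p * f x)))"
    and antinode_pos: "0 \<le> 1 + \<epsilon> * antinode n f"
  shows "J p u \<le> J p (\<lambda>x. u x + \<epsilon> * zero_extension f x)"
proof -
  define w where "w x = 1 + \<epsilon> * f x" for x
  define Q where "Q = integral I (\<lambda>x. \<bar>2 * x\<bar> ^ p * f x)"
  have w: "continuous_on I w"
    unfolding w_def by (intro continuous_intros f)
  have v: "(\<lambda>x. u x + \<epsilon> * zero_extension f x) = zero_extension w"
    by (auto simp: u_def zero_extension_def w_def indicator_def)
  have nonneg: "0 \<le> w x" if "x \<in> I" for x
    using pos[OF that] by (simp add: w_def)
  have mass: "integral I w = 1 + \<epsilon> * integral I f"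
    unfolding w_def
    by (subst integral_add; (intro integrable_on_I continuous_intros f)?; simp)
  have weight: "integral I (\<lambda>x. \<bar>2 * x\<bar> ^ p * w x) = (1 + \<epsilon> * ((real p + 1) * Q)) / (real p + 1)"
  proof -
    have "integral I (\<lambda>x. \<bar>2 * x\<bar> ^ p * w x)
        = integral I (\<lambda>x. \<bar>2 * x\<bar> ^ p + \<epsilon> * (\<bar>2 * x\<bar> ^ p * f x))"
      by (simp add: w_def algebra_simps)
    also have "\<dots> = integral I (\<lambda>x. \<bar>2 * x\<bar> ^ p) + \<epsilon> * Q"
      unfolding Q_def
      by (subst integral_add; (intro integrable_on_I continuous_intros f)?; simp)
    finally show ?thesis
      unfolding integral_abs_power by (simp add: field_simps)
  qed
  have anti: "antinode n w = 1 + \<epsilon> * antinode n f"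
  proof -
    have "antinode n w = antinode n (\<lambda>x. 1 - (- \<epsilon>) * f x)"
      by (simp add: w_def[abs_def])
    also have "\<dots> = antinode n (\<lambda>_. 1) - antinode n (\<lambda>x. (- \<epsilon>) * f x)"
      by (intro antinode_diff continuous_intros f)
    finally show ?thesis
      unfolding antinode_cmult antinode_const by simp
  qed
  have mass_pos: "0 < integral I w"
  proof -
    have "integral I w \<noteq> 0"
      using integral_eq_0_iff[OF w] nonneg pos[of 0] by (auto simp: w_def)
    moreover have "0 \<le> integral I w"
      by (intro integral_nonneg integrable_on_I w nonneg)
    ultimately show ?thesis by simp
  qed
  have "(1 / pi) ^ p * (1 / (real p + 1) / 2 ^ p)
      \<le> (\<bar>antinode n w\<bar> / pi) ^ p * (integral I (\<lambda>x. \<bar>2 * x\<bar> ^ p * w x) / 2 ^ p)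
        / integral I w ^ (p + 1)"
  proof -
    \<comment> \<open>\<open>R\<close> is the right-hand side of the claim divided by its left-hand side.\<close>
    define R where "R = (1 + \<epsilon> * antinode n f) ^ p * (1 + \<epsilon> * ((real p + 1) * Q))
        / (1 + \<epsilon> * integral I f) ^ (p + 1)"
    have "1 \<le> R"
      using ineq zero_less_power[OF mass_pos, of "p + 1"]
      unfolding R_def Q_def mass by (simp only: le_divide_eq_1_pos)
    then have "(1 / pi) ^ p * (1 / (real p + 1) / 2 ^ p) * 1
        \<le> (1 / pi) ^ p * (1 / (real p + 1) / 2 ^ p) * R"
      by (intro mult_left_mono) auto
    also have "\<dots> = (\<bar>antinode n w\<bar> / pi) ^ p * (integral I (\<lambda>x. \<bar>2 * x\<bar> ^ p * w x) / 2 ^ p)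
        / integral I w ^ (p + 1)"
      unfolding weight R_def mass anti abs_of_nonneg[OF antinode_pos]
      by (simp add: power_divide)
    finally show ?thesis by simp
  qed
  then have "ennreal ((1 / pi) ^ p * (1 / (real p + 1) / 2 ^ p))
      \<le> ennreal ((\<bar>antinode n w\<bar> / pi) ^ p * (integral I (\<lambda>x. \<bar>2 * x\<bar> ^ p * w x) / 2 ^ p)
        / integral I w ^ (p + 1))"
    by (rule ennreal_leI)
  also have "\<dots> \<le> J p (zero_extension w)"
    by (rule J_ge_antinode[OF w nonneg mass_pos])
  finally show ?thesis
    using J_u_le[of p] unfolding v by (rule order_trans[rotated])
qed

text \<open>Both sides equal 1 at \<open>\<epsilon> = 0\<close>; the hypothesis compares their derivatives there.\<close>
lemma power_ratio_increasing:
  fixes a q m :: real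
  assumes "(real p + 1) * m < real p * a + q"
  shows "\<exists>\<delta>>0. \<forall>\<epsilon>. 0 < \<epsilon> \<and> \<epsilon> < \<delta> \<longrightarrow>
    (1 + \<epsilon> * m) ^ (p + 1) \<le> (1 + \<epsilon> * a) ^ p * (1 + \<epsilon> * q)"
proof -
  define F where "F \<epsilon> = (1 + \<epsilon> * a) ^ p * (1 + \<epsilon> * q) - (1 + \<epsilon> * m) ^ (p + 1)" for \<epsilon>
  have "(F has_real_derivative real p * a + q - (real p + 1) * m) (at 0)"
    unfolding F_def by (auto intro!: derivative_eq_intros simp: algebra_simps)
  from has_real_derivative_pos_inc_right[OF this] assms
  obtain d where "d > 0" "\<And>h. h > 0 \<Longrightarrow> h < d \<Longrightarrow> F 0 < F (0 + h)"
    by auto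
  then show ?thesis
    unfolding F_def by (intro exI[of _ d]) (auto intro: less_imp_le)
qed

lemma one_plus_small_pos:
  fixes B c :: real
  assumes "\<bar>c\<bar> \<le> B" "0 < B" "0 < \<epsilon>" "\<epsilon> < 1 / B"
  shows "0 < 1 + \<epsilon> * c"
proof -
  have "\<epsilon> * \<bar>c\<bar> \<le> \<epsilon> * B" using assms by (intro mult_left_mono) auto
  moreover have "\<epsilon> * B < 1" using assms by (simp add: field_simps)
  moreover have "\<bar>\<epsilon> * c\<bar> = \<epsilon> * \<bar>c\<bar>" using assms by (simp add: abs_mult)
  ultimately show ?thesis by linarith
qed

theorem theorem2:
  fixes \<alpha> :: nat and f :: "real \<Rightarrow> real"
  assumes "\<alpha> \<in> {2, 3, 4, 5, 6}"
    and "even_on_I f" and "smooth_on_I f"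
  shows "\<exists>\<epsilon>\<^sub>0>0. \<forall>\<epsilon>::real. 0 < \<epsilon> \<and> \<epsilon> < \<epsilon>\<^sub>0 \<longrightarrow>
           J \<alpha> (\<lambda>x. u x + \<epsilon> * zero_extension f x) \<ge> J \<alpha> u"
proof -
  have \<alpha>: "2 \<le> \<alpha>" "\<alpha> \<le> 6" using assms(1) by auto
  obtain D where D: "\<And>x. x \<in> I \<Longrightarrow> D 0 x = f x"
    "\<And>x. x \<in> I \<Longrightarrow> (D (0::nat) has_real_derivative D (Suc 0) x) (at x within I)"
    using assms(3) unfolding smooth_on_I_def by blast
  have "continuous_on I (D 0)"
    using D(2) by (intro DERIV_continuous_on)
  then have f: "continuous_on I f"
    using D(1) by (rule continuous_on_eq)
  define M where "M = integral I f"
  define Q where "Q = integral I (\<lambda>x. \<bar>2 * x\<bar> ^ \<alpha> * f x)"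
  have profile: "integral I (\<lambda>x. f x * (1 - \<bar>2 * x\<bar> ^ \<alpha>)) = M - Q"
  proof -
    have "integral I (\<lambda>x. f x * (1 - \<bar>2 * x\<bar> ^ \<alpha>)) = integral I (\<lambda>x. f x - \<bar>2 * x\<bar> ^ \<alpha> * f x)"
      by (simp add: algebra_simps)
    also have "\<dots> = M - Q"
      unfolding M_def Q_def by (intro integral_diff integrable_on_I continuous_intros f)
    finally show ?thesis .
  qed
  obtain B where B: "B > 0" "\<And>x. x \<in> I \<Longrightarrow> \<bar>f x\<bar> \<le> B"
    using bounded_on_I[OF f] by blast
  \<comment> \<open>Either some antinode value beats the average, and the first variation is positive, or \<open>f\<close> is
    constant and both sides agree because the quotient is invariant under scaling.\<close>
  have "\<exists>n \<delta>. 0 < \<delta> \<and> (\<forall>\<epsilon>. 0 < \<epsilon> \<and> \<epsilon> < \<delta> \<longrightarrow> (1 + \<epsilon> * M) ^ (\<alpha> + 1)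
      \<le> (1 + \<epsilon> * antinode n f) ^ \<alpha> * (1 + \<epsilon> * ((real \<alpha> + 1) * Q)))"
  proof (cases "\<exists>n. (real \<alpha> + 1) * (M - Q) < real \<alpha> * antinode n f")
    case True
    then obtain n where "(real \<alpha> + 1) * M < real \<alpha> * antinode n f + (real \<alpha> + 1) * Q"
      by (auto simp: algebra_simps)
    from power_ratio_increasing[OF this] show ?thesis by blast
  next
    case False
    then have "real \<alpha> * antinode n f \<le> (real \<alpha> + 1) * (M - Q)" for n
      by (simp add: not_less)
    then obtain A where A: "\<And>x. x \<in> I \<Longrightarrow> f x = A"
      using const_if_profile_dominates_antinodes[OF \<alpha> f assms(2)] unfolding profile by blast
    have "M = integral I (\<lambda>_. A)"
      unfolding M_def by (rule integral_cong) (rule A)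
    moreover have "Q = integral I (\<lambda>x. \<bar>2 * x\<bar> ^ \<alpha> * A)"
      unfolding Q_def by (rule integral_cong) (simp only: A)
    moreover have "odd_coeff 0 f = odd_coeff 0 (\<lambda>_. A)"
      unfolding odd_coeff_def by (rule integral_cong) (simp only: A)
    then have "antinode 0 f = A"
      using antinode_const[of 0 A] by (simp only: antinode_def)
    ultimately have "M = A" "(real \<alpha> + 1) * Q = A" "antinode 0 f = A"
      using integral_abs_power[of \<alpha>] by simp_all
    then show ?thesis
      by (intro exI[of _ 0] exI[of _ 1]) simp
  qed
  then obtain n \<delta> where \<delta>: "0 < \<delta>"
    and ineq: "\<And>\<epsilon>. 0 < \<epsilon> \<Longrightarrow> \<epsilon> < \<delta> \<Longrightarrow> (1 + \<epsilon> * M) ^ (\<alpha> + 1)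
      \<le> (1 + \<epsilon> * antinode n f) ^ \<alpha> * (1 + \<epsilon> * ((real \<alpha> + 1) * Q))"
    by blast
  \<comment> \<open>\<open>\<epsilon> < 1 / C\<close> keeps \<open>1 + \<epsilon> f\<close> and the antinode value \<open>1 + \<epsilon> a\<^sub>n\<close> positive.\<close>
  define C where "C = max B \<bar>antinode n f\<bar>"
  have C: "0 < C" "\<bar>antinode n f\<bar> \<le> C" "\<And>x. x \<in> I \<Longrightarrow> \<bar>f x\<bar> \<le> C"
    using B by (auto simp: C_def le_max_iff_disj)
  show ?thesis
  proof (intro exI[of _ "min \<delta> (1 / C)"] conjI allI impI)
    show "0 < min \<delta> (1 / C)" using \<delta> C by simp
    fix \<epsilon> :: real
    assume \<epsilon>: "0 < \<epsilon> \<and> \<epsilon> < min \<delta> (1 / C)"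
    then have small: "0 < 1 + \<epsilon> * c" if "\<bar>c\<bar> \<le> C" for c
      using one_plus_small_pos[OF that C(1)] by simp
    show "J \<alpha> u \<le> J \<alpha> (\<lambda>x. u x + \<epsilon> * zero_extension f x)"
    proof (rule J_perturbation_ge[OF f])
      show "0 < 1 + \<epsilon> * f x" if "x \<in> I" for x
        using small C(3)[OF that] by blast
      show "0 \<le> 1 + \<epsilon> * antinode n f"
        using small[OF C(2)] by simp
    qed (use ineq \<epsilon> in \<open>simp add: M_def Q_def\<close>)
  qed
qed

end
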